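(* Let $S \subset \mathbb{R}^2$ be a compact surface with boundary that is the union of finitely many horizontal and vertical line segments. Then for any C$^1$ vector field $\mathbf{F} = \begin{pmatrix} M \\ N \end{pmatrix}$ on $S$, $$\int_{\partial S} \mathbf{F} \cdot d\mathbf{s} = \iint_{S} \operatorname{scurl} \mathbf{F} \, dA .$$
   Context: A vector field $\mathbf{F}\colon S\to\mathbb{R}^2$ is C$^1$ if it is differentiable on $S$ with continuous derivative. The scalar curl is $\operatorname{scurl}\begin{pmatrix} M \\ N\end{pmatrix}=\frac{\partial N}{\partial x}-\frac{\partial M}{\partial y}$. For a piecewise C$^1$ path $\phi\colon[a,b]\to S$, $\int_\phi\mathbf{F}\cdot d\mathbf{s}=\int_a^b\mathbf{F}(\phi(t))\cdot\phi'(t)\,dt$. The boundary $\partial S$ is given the orientation such that $S$ is always on the left, and $\int_{\partial S}\mathbf{F}\cdot d\mathbf{s}$ is the sum over the boundary components. A surface in $\mathbb{R}^2$ means a 2-dimensional (topological) submanifold with boundary; corners of the boundary are allowed. *)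

theory Defs
  imports "HOL-Analysis.Analysis"
begin

definition half_plane :: "(real \<times> real) set" where
  "half_plane = {q. snd q \<ge> 0}"

definition half_plane_chart ::
    "(real \<times> real) set \<Rightarrow> (real \<times> real) set \<Rightarrow> (real \<times> real \<Rightarrow> real \<times> real) \<Rightarrow> bool" where
  "half_plane_chart S U h \<longleftrightarrow>
     openin (top_of_set S) U \<and> openin (top_of_set half_plane) (h ` U) \<and>
     (\<exists>k. homeomorphism U (h ` U) h k)"

text \<open>Hausdorffness and second countability are automatic for subspaces of the plane.\<close>

definition surface_with_boundary :: "(real \<times> real) set \<Rightarrow> bool" where
  "surface_with_boundary S \<longleftrightarrow> (\<forall>p\<in>S. \<exists>U h. p \<in> U \<and> half_plane_chart S U h)"

definition surface_boundary :: "(real \<times> real) set \<Rightarrow> (real \<times> real) set" where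
  "surface_boundary S = {p \<in> S. \<exists>U h. p \<in> U \<and> half_plane_chart S U h \<and> snd (h p) = 0}"

definition horizontal_or_vertical_segment :: "(real \<times> real) set \<Rightarrow> bool" where
  "horizontal_or_vertical_segment s \<longleftrightarrow>
     (\<exists>a b. a \<noteq> b \<and> (fst a = fst b \<or> snd a = snd b) \<and> s = closed_segment a b)"

definition C1_vector_field :: "(real \<times> real) set \<Rightarrow> (real \<times> real \<Rightarrow> real \<times> real) \<Rightarrow> bool" where
  "C1_vector_field S F \<longleftrightarrow>
     (\<exists>F' :: real \<times> real \<Rightarrow> (real \<times> real) \<Rightarrow>\<^sub>L (real \<times> real).
        (\<forall>p\<in>S. (F has_derivative blinfun_apply (F' p)) (at p within S)) \<and> continuous_on S F')"

text \<open>The partial derivatives are taken along the slices of \<open>S\<close>, so that at boundary points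
  they depend only on the values of the field on \<open>S\<close>.\<close>

definition partial_x :: "(real \<times> real) set \<Rightarrow> (real \<times> real \<Rightarrow> real) \<Rightarrow> real \<times> real \<Rightarrow> real" where
  "partial_x S f p =
     vector_derivative (\<lambda>x. f (x, snd p)) (at (fst p) within {x. (x, snd p) \<in> S})"

definition partial_y :: "(real \<times> real) set \<Rightarrow> (real \<times> real \<Rightarrow> real) \<Rightarrow> real \<times> real \<Rightarrow> real" where
  "partial_y S f p =
     vector_derivative (\<lambda>y. f (fst p, y)) (at (snd p) within {y. (fst p, y) \<in> S})"

definition scurl ::
    "(real \<times> real) set \<Rightarrow> (real \<times> real \<Rightarrow> real \<times> real) \<Rightarrow> real \<times> real \<Rightarrow> real" where
  "scurl S F p = partial_x S (\<lambda>q. snd (F q)) p - partial_y S (\<lambda>q. fst (F q)) p"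

definition line_integral :: "(real \<times> real \<Rightarrow> real \<times> real) \<Rightarrow> (real \<Rightarrow> real \<times> real) \<Rightarrow> real" where
  "line_integral F \<phi> = integral {0..1} (\<lambda>t. F (\<phi> t) \<bullet> vector_derivative \<phi> (at t))"

definition rotate_left :: "real \<times> real \<Rightarrow> real \<times> real" where
  "rotate_left v = (- snd v, fst v)"

text \<open>Only parameters with a nonzero two-sided velocity are tested; corners and points where
  the path stops impose no condition. Since a simple path is not constant on any interval,
  the tested parameters are dense when the path is also piecewise continuously
  differentiable.\<close>

definition keeps_on_left :: "(real \<times> real) set \<Rightarrow> (real \<Rightarrow> real \<times> real) \<Rightarrow> bool" where
  "keeps_on_left S \<phi> \<longleftrightarrow>
     (\<forall>t\<in>{0<..<1}. \<forall>v. (\<phi> has_vector_derivative v) (at t) \<and> v \<noteq> 0 \<longrightarrow>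
        (\<forall>\<^sub>F e in at_right 0.
           \<phi> t + e *\<^sub>R rotate_left v \<in> S \<and> \<phi> t - e *\<^sub>R rotate_left v \<notin> S))"

text \<open>A parametrization, as a simple closed piecewise \<open>C\<^sup>1\<close> path, of the boundary
  component \<open>C\<close> of \<open>S\<close> in the boundary orientation.\<close>

definition oriented_parametrization ::
    "(real \<times> real) set \<Rightarrow> (real \<times> real) set \<Rightarrow> (real \<Rightarrow> real \<times> real) \<Rightarrow> bool" where
  "oriented_parametrization S C \<phi> \<longleftrightarrow>
     valid_path \<phi> \<and> simple_path \<phi> \<and> pathfinish \<phi> = pathstart \<phi> \<and> path_image \<phi> = C \<and>
     keeps_on_left S \<phi>"

end

theory Submission
  imports Defs
begin

text \<open>
  The boundary of the surface in the sense of charts is its topological frontier, by invariance of domain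
  (\<open>surface_boundary_eq_frontier\<close>). It lies in finitely many vertical lines \<open>x \<in> X\<close> and finitely
  many horizontal lines \<open>y \<in> Y\<close>. Both sides of the identity split into a part with \<open>N\<close> and a part
  with \<open>M\<close>; exchanging the coordinates, which reverses orientation, carries one into the other. It
  remains to compare the sum over the boundary paths of the integrals of \<open>N dy\<close> with the area integral of
  \<open>\<partial>N/\<partial>x\<close>.

  Each of these is computed as an integral over \<open>y\<close> of the same quantity, namely the sum over
  \<open>x \<in> X\<close> of \<open>N (x, y)\<close> times the jump of the indicator of the surface at \<open>(x, y)\<close>. For the area
  integral this is Fubini's theorem, followed on almost every row by the fundamental theorem of calculus on
  a finite union of intervals (\<open>has_integral_with_jumps\<close>,
  \<open>integral_eq_sum_integral_jump_density\<close>). For a boundary path, \<open>dy\<close> vanishes along horizontal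
  pieces. Along a vertical piece, having the surface on the left says exactly that the sign of the
  vertical velocity is the jump (\<open>velocity_along_vertical_edge\<close>); since the path is simple, the
  change of variables formula for injective functions replaces the time by the height
  (\<open>has_integral_along_path\<close>). In this way the boundary is never cut into edges that
  would have to be ordered along the path: a measurable set of times and its image are enough. Finally the components of the
  frontier are disjoint and cover it, so the contributions of the paths add up to the full integral
  over each vertical line (\<open>sum_integrals_along_boundary\<close>).
\<close>

section \<open>The manifold boundary is the topological frontier\<close>

text \<open>A chart restricted to a neighbourhood that is open in the plane is an injective continuous map
  of the plane, so by invariance of domain it preserves interiors in both directions; and the
  interior of the half-plane consists of the points off its bounding line.\<close>

lemma chart_point_interior_iff:
  assumes "half_plane_chart S U h" "p \<in> U"
  shows "p \<in> interior S \<longleftrightarrow> snd (h p) \<noteq> 0"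
proof -
  from assms(1) obtain k where oU: "openin (top_of_set S) U"
    and oH: "openin (top_of_set half_plane) (h ` U)" and hk: "homeomorphism U (h ` U) h k"
    unfolding half_plane_chart_def by blast
  from oU obtain T where T: "open T" "U = S \<inter> T" by (auto simp: openin_open)
  from oH obtain V where V: "open V" "h ` U = half_plane \<inter> V" by (auto simp: openin_open)
  have conth: "continuous_on U h" and contk: "continuous_on (h ` U) k"
    and kim: "k ` h ` U = U" and kh: "\<And>x. x \<in> U \<Longrightarrow> k (h x) = x"
    using hk unfolding homeomorphism_def by simp_all
  have injh: "inj_on h U" using kh by (rule inj_on_inverseI)
  have injk: "inj_on k (h ` U)" using kh by (intro inj_on_inverseI[of _ h]) auto
  have int_half: "interior half_plane = {q. snd q > 0}"
  proof -
    have "half_plane = {q. (0, 1) \<bullet> q \<ge> (0::real)}" by (simp add: half_plane_def inner_prod_def)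
    then have "interior half_plane = {q. (0, 1) \<bullet> q > (0::real)}"
      using interior_halfspace_ge[of "(0, 1) :: real \<times> real" 0] by (simp add: zero_prod_def)
    then show ?thesis by (simp add: inner_prod_def)
  qed
  have hp: "h p \<in> half_plane" using V assms(2) by blast
  show ?thesis
  proof
    assume p: "p \<in> interior S"
    let ?W = "T \<inter> interior S"
    have WU: "?W \<subseteq> U" using T interior_subset by blast
    have "open (h ` ?W)"
      using T(1) WU by (intro invariance_of_domain continuous_on_subset[OF conth]
          inj_on_subset[OF injh] open_Int) simp_all
    moreover have "h ` ?W \<subseteq> half_plane" using WU V by blast
    ultimately have "h ` ?W \<subseteq> interior half_plane" by (rule interior_maximal[rotated])
    then show "snd (h p) \<noteq> 0" using p assms(2) T int_half by auto
  next
    assume "snd (h p) \<noteq> 0"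
    let ?V = "V \<inter> interior half_plane"
    have VU: "?V \<subseteq> h ` U" using V interior_subset by blast
    have "open (k ` ?V)"
      using V(1) VU by (intro invariance_of_domain continuous_on_subset[OF contk]
          inj_on_subset[OF injk] open_Int) simp_all
    moreover have "k ` ?V \<subseteq> S" using VU kim T by blast
    moreover have "h p \<in> ?V" using \<open>snd (h p) \<noteq> 0\<close> hp V assms(2) int_half
      by (auto simp: half_plane_def)
    then have "p \<in> k ` ?V" using kh[OF assms(2)] by (metis imageI)
    ultimately show "p \<in> interior S" by (meson interiorI)
  qed
qed

lemma surface_boundary_eq_frontier:
  assumes "closed S" "surface_with_boundary S"
  shows "surface_boundary S = frontier S"
proof (intro equalityI subsetI)
  fix p assume "p \<in> surface_boundary S"
  then obtain U h where "p \<in> S" "p \<in> U" "half_plane_chart S U h" "snd (h p) = 0"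
    unfolding surface_boundary_def by blast
  then show "p \<in> frontier S"
    using chart_point_interior_iff[of S U h p] \<open>closed S\<close> by (simp add: frontier_def)
next
  fix p assume "p \<in> frontier S"
  then have p: "p \<in> S" "p \<notin> interior S" using \<open>closed S\<close> by (simp_all add: frontier_def)
  then obtain U h where "p \<in> U" "half_plane_chart S U h"
    using assms(2) unfolding surface_with_boundary_def by blast
  then show "p \<in> surface_boundary S"
    using p chart_point_interior_iff[of S U h p] unfolding surface_boundary_def by blast
qed

section \<open>The fundamental theorem of calculus on a finite union of intervals\<close>

lemma mem_iff_of_segment_disjoint_frontier:
  fixes A :: "'a::real_normed_vector set"
  assumes "closed_segment c d \<inter> frontier A = {}"
  shows "c \<in> A \<longleftrightarrow> d \<in> A"
  using connected_Int_frontier[of "closed_segment c d" A] assms by (auto simp: disjoint_iff)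

text \<open>An interval that misses the frontier of \<open>A\<close> lies in \<open>A\<close> or in its complement, and the witness
  \<open>c\<close> tells which. It may be an endpoint of the interval, so that adjacent gaps can be tested at
  prescribed points.\<close>

lemma has_integral_over_gap:
  fixes g g' :: "real \<Rightarrow> real"
  assumes "closed A" "a < b" and c: "c \<in> {a..b}" "c \<notin> frontier A"
    and gap: "{a<..<b} \<inter> frontier A = {}"
    and cont: "continuous_on A g"
    and deriv: "\<And>z. z \<in> A \<Longrightarrow> z \<in> {a<..<b} \<Longrightarrow> (g has_vector_derivative g' z) (at z)"
  shows "((\<lambda>z. if z \<in> A then g' z else 0) has_integral indicator A c * (g b - g a)) {a..b}"
proof -
  let ?T = "insert c {a<..<b}"
  have disj: "?T \<inter> frontier A = {}" using c gap by auto
  have "is_interval ?T" using c unfolding is_interval_1 by auto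
  then have conn: "connected ?T" by (simp add: is_interval_connected_1)
  show ?thesis
  proof (cases "c \<in> A")
    case True
    then have TA: "?T \<subseteq> A" using connected_Int_frontier[OF conn, of A] disj by blast
    have "closure {a<..<b} \<subseteq> A" using TA \<open>closed A\<close> by (intro closure_minimal) auto
    then have abA: "{a..b} \<subseteq> A" using \<open>a < b\<close> by simp
    have "(g' has_integral g b - g a) {a..b}"
      using \<open>a < b\<close> TA by (intro fundamental_theorem_of_calculus_interior
          continuous_on_subset[OF cont abA] deriv) auto
    then have "((\<lambda>z. if z \<in> A then g' z else 0) has_integral g b - g a) {a..b}"
      by (rule has_integral_eq[rotated]) (use abA in auto)
    then show ?thesis using True by simp
  next
    case False
    then have "?T \<inter> A = {}" using connected_Int_frontier[OF conn, of A] disj by blast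
    then have out: "z \<notin> A" if "a < z" "z < b" for z using that by auto
    have "((\<lambda>z. if z \<in> A then g' z else 0) has_integral 0) {a..b}"
      by (intro has_integral_spike_finite[OF _ _ has_integral_0, of "{a, b}"]) (use out in auto)
    then show ?thesis using False by simp
  qed
qed

text \<open>The endpoints of the components of \<open>A\<close> are enumerated from left to right. The separation of \<open>X\<close> makes
  the two points at distance \<open>\<delta>\<close> from \<open>x \<in> X\<close> lie in the two gaps next to \<open>x\<close>, so the coefficient
  of \<open>g x\<close> is \<open>1\<close> at a right end of \<open>A\<close>, \<open>-1\<close> at a left end, and \<open>0\<close> at a point where \<open>A\<close>
  continues or which is isolated in \<open>A\<close>.\<close>

lemma has_integral_with_jumps_interval:
  fixes g g' :: "real \<Rightarrow> real"
  assumes "finite X" "closed A" "0 < \<delta>"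
    and cont: "continuous_on A g"
    and "a < b" "\<And>x. x \<in> X \<Longrightarrow> a + \<delta> < x \<and> x + \<delta> < b"
    and "\<And>x x'. x \<in> X \<Longrightarrow> x' \<in> X \<Longrightarrow> x < x' \<Longrightarrow> x + 2 * \<delta> < x'"
    and "frontier A \<inter> {a..b} \<subseteq> X"
    and "\<And>z. z \<in> A \<Longrightarrow> z \<in> {a<..<b} \<Longrightarrow> z \<notin> X \<Longrightarrow> (g has_vector_derivative g' z) (at z)"
  shows "((\<lambda>z. if z \<in> A then g' z else 0) has_integral
           indicator A b * g b - indicator A a * g a
           + (\<Sum>x\<in>X. (indicator A (x - \<delta>) - indicator A (x + \<delta>)) * g x)) {a..b}"
  using assms(1,5-)
proof (induction X arbitrary: b rule: finite_linorder_max_induct)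
  case empty
  have "indicator A a = (indicator A b :: real)"
    using mem_iff_of_segment_disjoint_frontier[of a b A] empty
    by (auto simp: closed_segment_eq_real_ivl indicator_def)
  moreover have "a \<notin> frontier A" using empty by auto
  moreover have "{a<..<b} \<inter> frontier A = {}" using empty by auto
  ultimately show ?case
    using has_integral_over_gap[OF \<open>closed A\<close> \<open>a < b\<close> _ _ _ cont, of a] empty
    by (auto simp: algebra_simps)
next
  case (insert m X)
  have lt: "x + \<delta> < m - \<delta>" if "x \<in> X" for x
    using insert.hyps(2) insert.prems(3)[of x m] that by force
  have m: "a < m - \<delta>" "m + \<delta> < b" using insert.prems(2)[of m] by auto
  have nf: "z \<notin> frontier A" if "m - \<delta> \<le> z" "z \<le> b" "z \<noteq> m" for z
  proof
    assume "z \<in> frontier A"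
    moreover have "a \<le> z" using that m by simp
    ultimately have "z \<in> X" using insert.prems(4) that by auto
    then show False using lt[of z] that \<open>0 < \<delta>\<close> by simp
  qed
  have deriv: "(g has_vector_derivative g' z) (at z)"
    if "z \<in> A" "a < z" "z < b" "z \<noteq> m" "z \<notin> X" for z
    using insert.prems(5) that by simp
  have notX: "z \<notin> X" if "m - \<delta> \<le> z" for z using lt[of z] that \<open>0 < \<delta>\<close> by fastforce
  let ?f = "\<lambda>z. if z \<in> A then g' z else 0"
  let ?J = "\<Sum>x\<in>X. (indicator A (x - \<delta>) - indicator A (x + \<delta>)) * g x"
  have "(?f has_integral indicator A (m - \<delta>) * g (m - \<delta>) - indicator A a * g a + ?J) {a..m - \<delta>}"
  proof (rule insert.IH)
    show "frontier A \<inter> {a..m - \<delta>} \<subseteq> X" using insert.prems(4) m \<open>0 < \<delta>\<close> by auto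
    show "(g has_vector_derivative g' z) (at z)"
      if "z \<in> A" "z \<in> {a<..<m - \<delta>}" "z \<notin> X" for z
      using that m \<open>0 < \<delta>\<close> by (intro deriv) auto
  qed (use insert.prems(2-3) m lt in auto)
  moreover have "(?f has_integral indicator A (m - \<delta>) * (g m - g (m - \<delta>))) {m - \<delta>..m}"
    using m \<open>0 < \<delta>\<close> nf notX by (intro has_integral_over_gap \<open>closed A\<close> cont deriv) auto
  ultimately have *: "(?f has_integral indicator A (m - \<delta>) * g (m - \<delta>) - indicator A a * g a + ?J
      + indicator A (m - \<delta>) * (g m - g (m - \<delta>))) {a..m}"
    by (rule has_integral_combine[rotated 2]) (use m \<open>0 < \<delta>\<close> in auto)
  have "(?f has_integral indicator A (m + \<delta>) * (g b - g m)) {m..b}"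
    using m \<open>0 < \<delta>\<close> nf notX by (intro has_integral_over_gap \<open>closed A\<close> cont deriv) auto
  with * have "(?f has_integral indicator A (m - \<delta>) * g (m - \<delta>) - indicator A a * g a + ?J
      + indicator A (m - \<delta>) * (g m - g (m - \<delta>)) + indicator A (m + \<delta>) * (g b - g m)) {a..b}"
    by (rule has_integral_combine[rotated 2]) (use m \<open>0 < \<delta>\<close> in auto)
  moreover have "indicator A (m + \<delta>) = (indicator A b :: real)"
    using mem_iff_of_segment_disjoint_frontier[of "m + \<delta>" b A] nf m \<open>0 < \<delta>\<close>
    by (auto simp: closed_segment_eq_real_ivl indicator_def disjoint_iff)
  moreover have "m \<notin> X" using insert.hyps(2) by auto
  ultimately show ?case using insert.hyps(1) by (simp add: algebra_simps)
qed

lemma has_integral_with_jumps: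
  fixes g g' :: "real \<Rightarrow> real"
  assumes "compact A" "finite X" "frontier A \<subseteq> X" "0 < \<delta>"
    and sep: "\<And>x x'. x \<in> X \<Longrightarrow> x' \<in> X \<Longrightarrow> x < x' \<Longrightarrow> x + 2 * \<delta> < x'"
    and cont: "continuous_on A g"
    and deriv: "\<And>z. z \<in> A \<Longrightarrow> z \<notin> X \<Longrightarrow> (g has_vector_derivative g' z) (at z)"
  shows "((\<lambda>z. if z \<in> A then g' z else 0) has_integral
           (\<Sum>x\<in>X. (indicator A (x - \<delta>) - indicator A (x + \<delta>)) * g x)) UNIV"
proof -
  have "bounded (A \<union> X)" using assms by (simp add: compact_imp_bounded finite_imp_bounded)
  then obtain B where B: "\<And>z. z \<in> A \<union> X \<Longrightarrow> \<bar>z\<bar> < B" "0 < B"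
    using bounded_pos_less[of "A \<union> X"] by auto
  \<comment> \<open>The margin \<open>\<delta>\<close> keeps the test points next to the elements of \<open>X\<close> inside the interval.\<close>
  let ?b = "B + \<delta>"
  have out: "?b \<notin> A" "- ?b \<notin> A" using B(1)[of ?b] B(1)[of "- ?b"] \<open>0 < \<delta>\<close> B(2) by auto
  have sub: "A \<subseteq> {- ?b..?b}"
  proof
    fix z assume "z \<in> A"
    then show "z \<in> {- ?b..?b}" using B(1)[of z] \<open>0 < \<delta>\<close> by auto
  qed
  have X: "- ?b + \<delta> < x \<and> x + \<delta> < ?b" if "x \<in> X" for x
    using B(1)[of x] that \<open>0 < \<delta>\<close> by auto
  have "((\<lambda>z. if z \<in> A then g' z else 0) has_integral
           (\<Sum>x\<in>X. (indicator A (x - \<delta>) - indicator A (x + \<delta>)) * g x)) {- ?b..?b}"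
    using has_integral_with_jumps_interval[OF \<open>finite X\<close> compact_imp_closed[OF \<open>compact A\<close>] \<open>0 < \<delta>\<close>
        cont _ X sep] deriv out B(2) \<open>0 < \<delta>\<close> \<open>frontier A \<subseteq> X\<close>
    by (auto simp: indicator_def)
  then show ?thesis
    by (rule has_integral_on_superset) (use sub in auto)
qed

lemma finite_set_separated:
  fixes X :: "real set"
  assumes "finite X"
  obtains \<delta> where "0 < \<delta>" "\<And>x x'. x \<in> X \<Longrightarrow> x' \<in> X \<Longrightarrow> x < x' \<Longrightarrow> x + 2 * \<delta> < x'"
proof -
  let ?G = "insert 1 {d \<in> (\<lambda>(x, x'). x' - x) ` (X \<times> X). 0 < d}"
  have fin: "finite ?G" using assms by auto
  show thesis
  proof
    show "0 < Min ?G / 3" using fin by (subst zero_less_divide_iff) (auto simp: Min_gr_iff)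
    fix x x' assume "x \<in> X" "x' \<in> X" "x < x'"
    then have "x' - x \<in> ?G" by force
    then have "Min ?G \<le> x' - x" using fin by (rule Min_le[rotated])
    moreover have "0 < Min ?G" using fin by (auto simp: Min_gr_iff)
    ultimately show "x + 2 * (Min ?G / 3) < x'" by (simp add: field_simps)
  qed
qed

section \<open>The jumps of a region across vertical lines\<close>

text \<open>For generic \<open>y\<close> and small \<open>\<delta>\<close> this is \<open>1\<close> where the boundary of \<open>S\<close> has \<open>S\<close> on its left
  side only (smaller abscissa), \<open>-1\<close> where it has \<open>S\<close> on its right side only, and \<open>0\<close> elsewhere. A
  fixed \<open>\<delta>\<close>, rather than a limit, makes measurability in \<open>y\<close> evident.\<close>

definition jump :: "real \<Rightarrow> (real \<times> real) set \<Rightarrow> real \<Rightarrow> real \<Rightarrow> real" where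
  "jump \<delta> S x y = indicator S (x - \<delta>, y) - indicator S (x + \<delta>, y)"

text \<open>The indicator extends \<open>N\<close> by zero, since nothing is known about its values off \<open>S\<close>.\<close>

definition jump_density ::
    "real \<Rightarrow> (real \<times> real) set \<Rightarrow> (real \<times> real \<Rightarrow> real) \<Rightarrow> real \<Rightarrow> real \<Rightarrow> real" where
  "jump_density \<delta> S N x y = jump \<delta> S x y * (indicator S (x, y) * N (x, y))"

lemma compact_row:
  fixes S :: "(real \<times> real) set"
  assumes "compact S"
  shows "compact {x. (x, y) \<in> S}"
proof -
  have "{x. (x, y) \<in> S} = fst ` (S \<inter> snd -` {y})" by force
  moreover have "compact (S \<inter> snd -` {y})"
    using assms by (intro compact_Int_closed closed_vimage continuous_on_snd continuous_on_id) auto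
  ultimately show ?thesis by (simp add: compact_continuous_image continuous_on_fst)
qed

lemma compact_column:
  fixes S :: "(real \<times> real) set"
  assumes "compact S"
  shows "compact {y. (x, y) \<in> S}"
proof -
  have "{y. (x, y) \<in> S} = snd ` (S \<inter> fst -` {x})" by force
  moreover have "compact (S \<inter> fst -` {x})"
    using assms by (intro compact_Int_closed closed_vimage continuous_on_fst continuous_on_id) auto
  ultimately show ?thesis by (simp add: compact_continuous_image continuous_on_snd)
qed

lemma integrable_jump_density:
  assumes "compact S" "continuous_on S N"
  shows "integrable lborel (jump_density \<delta> S N x)"
proof -
  let ?col = "\<lambda>x. {y. (x, y) \<in> S}"
  have col: "?col z \<in> sets lborel" for z
    using compact_column[OF assms(1), of z] by (simp add: borel_compact)
  have "continuous_on (?col x) (\<lambda>y. N (x, y))"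
    by (rule continuous_on_compose2[OF assms(2)]) (auto intro!: continuous_intros)
  then have "integrable lborel (\<lambda>y. indicator (?col x) y *\<^sub>R N (x, y))"
    by (rule borel_integrable_compact[OF compact_column[OF assms(1)]])
  then have "integrable lborel (\<lambda>y. indicator (?col z) y *\<^sub>R (indicator (?col x) y *\<^sub>R N (x, y)))" for z
    by (rule integrable_mult_indicator[OF col])
  from Bochner_Integration.integrable_diff[OF this this, of "x - \<delta>" "x + \<delta>"]
  show ?thesis
    by (rule back_subst[of "integrable lborel"])
      (auto simp: jump_density_def jump_def indicator_def fun_eq_iff)
qed

lemma mem_iff_in_strip:
  fixes S :: "(real \<times> real) set"
  assumes fr: "frontier S \<subseteq> X \<times> UNIV \<union> UNIV \<times> Y" and "y \<notin> Y"
    and "closed_segment u v \<inter> X = {}"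
  shows "(u, y) \<in> S \<longleftrightarrow> (v, y) \<in> S"
proof (rule mem_iff_of_segment_disjoint_frontier)
  have "closed_segment (u, y) (v, y) \<subseteq> closed_segment u v \<times> {y}"
    by (auto dest: closed_segment_PairD)
  then show "closed_segment (u, y) (v, y) \<inter> frontier S = {}" using assms by fast
qed

lemma jump_eq_0:
  assumes "closed S" "frontier S \<subseteq> X \<times> UNIV \<union> UNIV \<times> Y" "y \<notin> Y"
    and "(x, y) \<notin> frontier S" "0 < \<delta>" and gap: "X \<inter> {x - \<delta>..x + \<delta>} \<subseteq> {x}"
  shows "jump \<delta> S x y = 0"
proof -
  have "closed_segment (x - \<delta>, y) (x + \<delta>, y) \<inter> frontier S = {}"
  proof -
    have "closed_segment (x - \<delta>, y) (x + \<delta>, y) \<subseteq> closed_segment (x - \<delta>) (x + \<delta>) \<times> {y}"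
      by (auto dest: closed_segment_PairD)
    then show ?thesis using assms by (force simp: closed_segment_eq_real_ivl)
  qed
  from mem_iff_of_segment_disjoint_frontier[OF this] show ?thesis
    by (simp add: jump_def indicator_def)
qed

text \<open>Between \<open>x\<close> and a point at distance at most \<open>\<delta>\<close> the horizontal line does not meet the frontier, so
  two test points arbitrarily close to \<open>x\<close> decide the jump. The number \<open>r\<close> is signed: for negative
  \<open>r\<close> the region lies to the right.\<close>

lemma jump_eq_of_sides:
  assumes fr: "frontier S \<subseteq> X \<times> UNIV \<union> UNIV \<times> Y" "y \<notin> Y"
    and "0 < \<bar>r\<bar>" "\<bar>r\<bar> \<le> \<delta>" and gap: "X \<inter> {x - \<delta>..x + \<delta>} \<subseteq> {x}"
    and side: "(x - r, y) \<in> S" "(x + r, y) \<notin> S"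
  shows "jump \<delta> S x y = sgn r"
proof -
  have off: "closed_segment (x - \<bar>r\<bar>) (x - \<delta>) \<inter> X = {}" "closed_segment (x + \<bar>r\<bar>) (x + \<delta>) \<inter> X = {}"
    using assms(3,4) gap by (force simp: closed_segment_eq_real_ivl)+
  have l: "(x - \<bar>r\<bar>, y) \<in> S \<longleftrightarrow> (x - \<delta>, y) \<in> S" by (rule mem_iff_in_strip[OF fr off(1)])
  have r: "(x + \<bar>r\<bar>, y) \<in> S \<longleftrightarrow> (x + \<delta>, y) \<in> S" by (rule mem_iff_in_strip[OF fr off(2)])
  show ?thesis
    using l r side \<open>0 < \<bar>r\<bar>\<close> by (cases "r > 0") (auto simp: jump_def indicator_def)
qed

lemma isolated_of_separated:
  fixes X :: "real set"
  assumes "0 < \<delta>" "\<And>x x'. x \<in> X \<Longrightarrow> x' \<in> X \<Longrightarrow> x < x' \<Longrightarrow> x + 2 * \<delta> < x'" "x \<in> X"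
  shows "X \<inter> {x - \<delta>..x + \<delta>} \<subseteq> {x}"
proof
  fix z assume "z \<in> X \<inter> {x - \<delta>..x + \<delta>}"
  then show "z \<in> {x}"
    using assms(1) assms(2)[of x z] assms(2)[of z x] assms(3) by (cases z x rule: linorder_cases) auto
qed

section \<open>The area integral as an integral of jumps\<close>

text \<open>By Fubini the integral is taken over rows. All rows outside the finite set \<open>Y\<close> have their frontier in
  \<open>X\<close>, and on them the fundamental theorem with jumps applies.\<close>

lemma integral_eq_sum_integral_jump_density:
  fixes N D :: "real \<times> real \<Rightarrow> real"
  assumes "compact S" and fin: "finite X" "finite Y"
    and fr: "frontier S \<subseteq> X \<times> UNIV \<union> UNIV \<times> Y"
    and \<delta>: "0 < \<delta>" "\<And>x x'. x \<in> X \<Longrightarrow> x' \<in> X \<Longrightarrow> x < x' \<Longrightarrow> x + 2 * \<delta> < x'"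
    and N: "continuous_on S N" and D: "continuous_on S D"
    and deriv: "\<And>p. p \<in> interior S \<Longrightarrow>
      ((\<lambda>x. N (x, snd p)) has_vector_derivative D p) (at (fst p))"
  shows "integral S D = (\<Sum>x\<in>X. integral UNIV (jump_density \<delta> S N x))"
proof -
  let ?row = "\<lambda>y. {x. (x, y) \<in> S}"
  have isolated: "X \<inter> {x - \<delta>..x + \<delta>} \<subseteq> {x}" if "x \<in> X" for x
    using isolated_of_separated[OF \<delta> that] by simp
  let ?D = "\<lambda>p. indicator S p *\<^sub>R D p"
  have intD: "integrable lborel ?D" by (rule borel_integrable_compact[OF \<open>compact S\<close> D])
  have uncurry: "(\<lambda>(x, y). ?D (x, y)) = ?D" by auto
  have intD': "integrable (lborel \<Otimes>\<^sub>M lborel) (\<lambda>(x, y). ?D (x, y))"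
    unfolding uncurry lborel_prod by (rule intD)
  have row: "(LINT x|lborel. ?D (x, y)) = (\<Sum>x\<in>X. jump_density \<delta> S N x y)" if "y \<notin> Y" for y
  proof -
    have fr_row: "frontier (?row y) \<subseteq> X"
    proof
      fix x assume x: "x \<in> frontier (?row y)"
      have "(x, y) \<in> frontier S"
      proof (rule ccontr)
        assume "(x, y) \<notin> frontier S"
        moreover have "x \<in> ?row y"
          using x compact_imp_closed[OF compact_row[OF \<open>compact S\<close>, of y]] by (auto simp: frontier_def)
        ultimately have "(x, y) \<in> interior S"
          using compact_imp_closed[OF \<open>compact S\<close>] by (auto simp: frontier_def)
        moreover have "open ((\<lambda>x. (x, y)) -` interior S)"
          by (intro open_vimage continuous_intros) auto
        moreover have "(\<lambda>x. (x, y)) -` interior S \<subseteq> ?row y" using interior_subset by auto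
        ultimately have "x \<in> interior (?row y)" by (meson interiorI vimageI2)
        then show False using x by (simp add: frontier_def)
      qed
      then show "x \<in> X" using fr \<open>y \<notin> Y\<close> by auto
    qed
    have "((\<lambda>z. if z \<in> ?row y then D (z, y) else 0) has_integral
        (\<Sum>x\<in>X. (indicator (?row y) (x - \<delta>) - indicator (?row y) (x + \<delta>)) * N (x, y))) UNIV"
    proof (rule has_integral_with_jumps[OF compact_row[OF \<open>compact S\<close>] fin(1) fr_row \<delta>])
      show "continuous_on (?row y) (\<lambda>x. N (x, y))"
        by (rule continuous_on_compose2[OF N]) (auto intro!: continuous_intros)
      fix z assume "z \<in> ?row y" "z \<notin> X"
      then have "(z, y) \<in> interior S"
        using fr \<open>y \<notin> Y\<close> compact_imp_closed[OF \<open>compact S\<close>] by (auto simp: frontier_def)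
      from deriv[OF this] show "((\<lambda>x. N (x, y)) has_vector_derivative D (z, y)) (at z)" by simp
    qed
    moreover have "jump_density \<delta> S N x y =
        (indicator (?row y) (x - \<delta>) - indicator (?row y) (x + \<delta>)) * N (x, y)" if "x \<in> X" for x
    proof (cases "(x, y) \<in> S")
      case False
      then have "(x, y) \<notin> frontier S"
        using compact_imp_closed[OF \<open>compact S\<close>] by (auto simp: frontier_def)
      from jump_eq_0[OF compact_imp_closed[OF \<open>compact S\<close>] fr \<open>y \<notin> Y\<close> this \<delta>(1) isolated[OF that]]
      show ?thesis by (auto simp: jump_density_def jump_def indicator_def split: if_splits)
    qed (auto simp: jump_density_def jump_def indicator_def)
    moreover have "((\<lambda>z. ?D (z, y)) has_integral (LINT x|lborel. ?D (x, y))) UNIV"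
    proof (rule has_integral_integral_lborel)
      have "continuous_on (?row y) (\<lambda>x. D (x, y))"
        by (rule continuous_on_compose2[OF D]) (auto intro!: continuous_intros)
      from borel_integrable_compact[OF compact_row[OF \<open>compact S\<close>] this]
      show "integrable lborel (\<lambda>x. ?D (x, y))" by (simp add: indicator_def)
    qed
    moreover have "(\<lambda>z. if z \<in> ?row y then D (z, y) else 0) = (\<lambda>z. ?D (z, y))"
      by (auto simp: indicator_def)
    ultimately show ?thesis
      by (auto dest: has_integral_unique)
  qed
  have "integral S D = integral UNIV ?D"
    by (subst integral_restrict_UNIV[symmetric]) (auto simp: indicator_def intro!: arg_cong[of _ _ "integral UNIV"])
  also have "\<dots> = integral\<^sup>L lborel ?D"
    using has_integral_integral_lborel[OF intD] by (rule integral_unique)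
  also have "\<dots> = (LINT y|lborel. LINT x|lborel. ?D (x, y))"
    using lborel_pair.integral_snd[OF intD'] unfolding uncurry lborel_prod by simp
  also have "\<dots> = (LINT y|lborel. (\<Sum>x\<in>X. jump_density \<delta> S N x y))"
  proof (rule integral_cong_AE)
    have "AE y in lborel. y \<notin> Y"
      using finite_imp_null_set_lborel[OF fin(2)] by (rule AE_not_in)
    then show "AE y in lborel. (LINT x|lborel. ?D (x, y)) = (\<Sum>x\<in>X. jump_density \<delta> S N x y)"
      by eventually_elim (rule row)
    show "(\<lambda>y. LINT x|lborel. ?D (x, y)) \<in> borel_measurable lborel"
      using lborel_pair.integrable_snd[OF intD'] by simp
    show "(\<lambda>y. \<Sum>x\<in>X. jump_density \<delta> S N x y) \<in> borel_measurable lborel"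
      using integrable_jump_density[OF \<open>compact S\<close> N] by (intro borel_measurable_sum) auto
  qed
  also have "\<dots> = (\<Sum>x\<in>X. integral\<^sup>L lborel (jump_density \<delta> S N x))"
    by (rule Bochner_Integration.integral_sum) (rule integrable_jump_density[OF \<open>compact S\<close> N])
  also have "\<dots> = (\<Sum>x\<in>X. integral UNIV (jump_density \<delta> S N x))"
    using integral_lborel[OF integrable_jump_density[OF \<open>compact S\<close> N]] by (intro sum.cong) auto
  finally show ?thesis .
qed

section \<open>The line integral as an integral of jumps\<close>

lemma isCont_tendsto_nhds: "isCont f t \<Longrightarrow> (f \<longlongrightarrow> f t) (nhds t)"
  unfolding isCont_def by (simp add: tendsto_at_iff_tendsto_nhds)

text \<open>By continuity a function that takes only finitely many values near a point is constant there.\<close>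

lemma vector_derivative_0_if_finitely_valued:
  fixes f :: "real \<Rightarrow> real"
  assumes "(f has_vector_derivative v) (at t)" "finite Z" "\<forall>\<^sub>F u in nhds t. f u \<in> Z"
  shows "v = 0"
proof -
  have "isCont f t" using assms(1) by (rule has_vector_derivative_continuous)
  then have "(f \<longlongrightarrow> f t) (nhds t)" by (rule isCont_tendsto_nhds)
  moreover have "open (- (Z - {f t}))" by (intro open_Compl finite_imp_closed finite_Diff assms(2))
  ultimately have "\<forall>\<^sub>F u in nhds t. f u \<in> - (Z - {f t})"
    by (rule topological_tendstoD) simp
  with assms(3) have "\<forall>\<^sub>F u in nhds t. f u = f t" by eventually_elim auto
  then have "(f has_real_derivative v) (at t) \<longleftrightarrow> ((\<lambda>_. f t) has_real_derivative v) (at t)"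
    by (intro DERIV_cong_ev) auto
  then show ?thesis
    using assms(1) DERIV_unique[OF _ DERIV_const, of "f t" v t]
    by (simp add: has_real_derivative_iff_has_vector_derivative)
qed

text \<open>Exchanging the coordinates reverses orientation, so both orientations are needed: \<open>s = 1\<close> keeps
  \<open>S\<close> on the left and \<open>s = -1\<close> keeps it on the right.\<close>

definition keeps_on_side :: "real \<Rightarrow> (real \<times> real) set \<Rightarrow> (real \<Rightarrow> real \<times> real) \<Rightarrow> bool" where
  "keeps_on_side s S \<phi> \<longleftrightarrow>
     (\<forall>t\<in>{0<..<1}. \<forall>v. (\<phi> has_vector_derivative v) (at t) \<and> v \<noteq> 0 \<longrightarrow>
        (\<forall>\<^sub>F e in at_right 0.
           \<phi> t + (s * e) *\<^sub>R rotate_left v \<in> S \<and> \<phi> t - (s * e) *\<^sub>R rotate_left v \<notin> S))"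

text \<open>Away from the heights in \<open>Y\<close> the boundary consists of vertical pieces, so the velocity is vertical and
  the orientation condition compares the two horizontal neighbours of the point. The sign of the
  vertical velocity is therefore determined by the jump of the region.\<close>

lemma velocity_along_vertical_edge:
  fixes \<gamma> :: "real \<Rightarrow> real \<times> real"
  assumes fin: "finite X" "finite Y" and fr: "frontier S \<subseteq> X \<times> UNIV \<union> UNIV \<times> Y"
    and \<delta>: "0 < \<delta>" "X \<inter> {fst (\<gamma> t) - \<delta>..fst (\<gamma> t) + \<delta>} \<subseteq> {fst (\<gamma> t)}"
    and t: "t \<in> {0<..<1}" "snd (\<gamma> t) \<notin> Y"
    and im: "path_image \<gamma> \<subseteq> frontier S"
    and side: "keeps_on_side s S \<gamma>" and s: "s \<in> {1, -1}"
    and v: "(\<gamma> has_vector_derivative v) (at t)"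
  shows "snd v = s * (\<bar>snd v\<bar> * jump \<delta> S (fst (\<gamma> t)) (snd (\<gamma> t)))"
proof (cases "snd v = 0")
  case False
  have cont: "isCont \<gamma> t" using v by (rule has_vector_derivative_continuous)
  have "((\<lambda>u. snd (\<gamma> u)) \<longlongrightarrow> snd (\<gamma> t)) (nhds t)"
    by (rule isCont_tendsto_nhds[OF isCont_snd[OF cont]])
  then have "\<forall>\<^sub>F u in nhds t. snd (\<gamma> u) \<in> - Y"
    by (rule topological_tendstoD) (use t fin in \<open>auto simp: finite_imp_closed\<close>)
  moreover have "\<forall>\<^sub>F u in nhds t. u \<in> {0<..<1}"
    using t by (intro eventually_nhds_in_open) auto
  ultimately have "\<forall>\<^sub>F u in nhds t. fst (\<gamma> u) \<in> X"
  proof eventually_elim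
    case (elim u)
    then have "\<gamma> u \<in> frontier S" using im by (auto simp: path_image_def)
    then show ?case using fr elim by (cases "\<gamma> u") auto
  qed
  moreover have "((\<lambda>u. fst (\<gamma> u)) has_vector_derivative fst v) (at t)"
    using bounded_linear.has_vector_derivative[OF bounded_linear_fst v] .
  ultimately have "fst v = 0" using fin by (intro vector_derivative_0_if_finitely_valued) auto
  then have rot: "rotate_left v = (- snd v, 0)" by (simp add: rotate_left_def)
  have "v \<noteq> 0" using False by auto
  then have "\<forall>\<^sub>F e in at_right 0. \<gamma> t + (s * e) *\<^sub>R rotate_left v \<in> S
      \<and> \<gamma> t - (s * e) *\<^sub>R rotate_left v \<notin> S"
    using side t v unfolding keeps_on_side_def by blast
  \<comment> \<open>The displacement \<open>e *\<^sub>R rotate_left v\<close> must have length at most \<open>\<delta>\<close>.\<close>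
  moreover have "\<forall>\<^sub>F e in at_right (0::real). 0 < e \<and> e < \<delta> / \<bar>snd v\<bar>"
    using False \<delta>(1) unfolding eventually_at_right_field by (intro exI[of _ "\<delta> / \<bar>snd v\<bar>"]) simp
  ultimately have "\<forall>\<^sub>F e in at_right (0::real). 0 < e \<and> e < \<delta> / \<bar>snd v\<bar>
      \<and> \<gamma> t + (s * e) *\<^sub>R rotate_left v \<in> S \<and> \<gamma> t - (s * e) *\<^sub>R rotate_left v \<notin> S"
    by eventually_elim auto
  then obtain e where e: "0 < e" "e < \<delta> / \<bar>snd v\<bar>"
      "\<gamma> t + (s * e) *\<^sub>R rotate_left v \<in> S" "\<gamma> t - (s * e) *\<^sub>R rotate_left v \<notin> S"
    by (auto dest: eventually_happens'[OF trivial_limit_at_right_real])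
  let ?r = "s * e * snd v"
  have "jump \<delta> S (fst (\<gamma> t)) (snd (\<gamma> t)) = sgn ?r"
  proof (rule jump_eq_of_sides[OF fr t(2) _ _ \<delta>(2)])
    show "0 < \<bar>?r\<bar>" using e False s by auto
    have "e * \<bar>snd v\<bar> < \<delta>" using e False by (simp add: field_simps)
    then show "\<bar>?r\<bar> \<le> \<delta>" using s e by (auto simp: abs_mult)
    show "(fst (\<gamma> t) - ?r, snd (\<gamma> t)) \<in> S" using e(3) rot by (cases "\<gamma> t") auto
    show "(fst (\<gamma> t) + ?r, snd (\<gamma> t)) \<notin> S" using e(4) rot by (cases "\<gamma> t") auto
  qed
  also have "sgn ?r = s * sgn (snd v)" using s e(1) by (auto simp: sgn_mult)
  finally have "s * (\<bar>snd v\<bar> * jump \<delta> S (fst (\<gamma> t)) (snd (\<gamma> t))) = (s * s) * (\<bar>snd v\<bar> * sgn (snd v))"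
    by (simp only: mult_ac)
  also have "\<dots> = snd v" using s by (auto simp: abs_mult_sgn)
  finally show ?thesis ..
qed simp

lemma velocity_along_horizontal_edge:
  fixes \<gamma> :: "real \<Rightarrow> real \<times> real"
  assumes fin: "finite X" "finite Y" and fr: "frontier S \<subseteq> X \<times> UNIV \<union> UNIV \<times> Y"
    and t: "t \<in> {0<..<1}" "fst (\<gamma> t) \<notin> X"
    and im: "path_image \<gamma> \<subseteq> frontier S"
    and v: "(\<gamma> has_vector_derivative v) (at t)"
  shows "snd v = 0"
proof -
  have cont: "isCont \<gamma> t" using v by (rule has_vector_derivative_continuous)
  have "((\<lambda>u. fst (\<gamma> u)) \<longlongrightarrow> fst (\<gamma> t)) (nhds t)"
    by (rule isCont_tendsto_nhds[OF isCont_fst[OF cont]])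
  then have "\<forall>\<^sub>F u in nhds t. fst (\<gamma> u) \<in> - X"
    by (rule topological_tendstoD) (use t fin in \<open>auto simp: finite_imp_closed\<close>)
  moreover have "\<forall>\<^sub>F u in nhds t. u \<in> {0<..<1}"
    using t by (intro eventually_nhds_in_open) auto
  ultimately have "\<forall>\<^sub>F u in nhds t. snd (\<gamma> u) \<in> Y"
  proof eventually_elim
    case (elim u)
    then have "\<gamma> u \<in> frontier S" using im by (auto simp: path_image_def)
    then show ?case using fr elim by (cases "\<gamma> u") auto
  qed
  moreover have "((\<lambda>u. snd (\<gamma> u)) has_vector_derivative snd v) (at t)"
    using bounded_linear.has_vector_derivative[OF bounded_linear_snd v] .
  ultimately show ?thesis using fin by (intro vector_derivative_0_if_finitely_valued) auto
qed

text \<open>On the set of times when the path runs through the line of abscissa \<open>x\<close>, the ordinate is injective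
  because the path is simple, and the sign of its derivative is given by the jump. The change of variables
  formula for injective functions on measurable sets then turns the integral over time into the integral
  of the jump density over the part of the line that the path covers. Integrability over
  time, where the derivative may be unbounded near the exceptional times, comes from that of the jump
  density through the same formula. At all other times, up to finitely many, the vertical velocity is zero.\<close>

lemma has_integral_along_path:
  fixes \<gamma> :: "real \<Rightarrow> real \<times> real"
  assumes "compact S" and fin: "finite X" "finite Y"
    and fr: "frontier S \<subseteq> X \<times> UNIV \<union> UNIV \<times> Y"
    and \<delta>: "0 < \<delta>" "\<And>x x'. x \<in> X \<Longrightarrow> x' \<in> X \<Longrightarrow> x < x' \<Longrightarrow> x + 2 * \<delta> < x'"
    and N: "continuous_on S N"
    and "simple_path \<gamma>" and "finite E"
    and der_off_E: "\<And>t. t \<in> {0..1} - E \<Longrightarrow> (\<gamma> has_vector_derivative \<gamma>' t) (at t)"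
    and im: "path_image \<gamma> \<subseteq> frontier S"
    and side: "keeps_on_side s S \<gamma>" and s: "s \<in> {1, -1}"
  shows "((\<lambda>t. N (\<gamma> t) * snd (\<gamma>' t)) has_integral
           s * (\<Sum>x\<in>X. integral {y. (x, y) \<in> path_image \<gamma>} (jump_density \<delta> S N x))) {0..1}"
proof -
  \<comment> \<open>The endpoints join the exceptional times, so that all other times are interior and the path
    is injective on them.\<close>
  define E' where "E' = insert 0 (insert 1 E)"
  have E': "finite E'" "0 \<in> E'" "1 \<in> E'" using \<open>finite E\<close> by (simp_all add: E'_def)
  have der: "(\<gamma> has_vector_derivative \<gamma>' t) (at t)" if "t \<in> {0..1}" "t \<notin> E'" for t
    using der_off_E that by (simp add: E'_def)
  have E01: "t \<in> {0<..<1}" if "t \<in> {0..1}" "t \<notin> E'" for t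
    using that E' by (metis atLeastAtMost_iff greaterThanLessThan_iff order_less_le)
  have cont: "continuous_on {0..1} \<gamma>"
    using \<open>simple_path \<gamma>\<close> by (simp add: simple_path_def path_def)
  have inj: "inj_on \<gamma> {0<..<1}"
  proof (rule inj_onI)
    fix t u :: real assume tu: "t \<in> {0<..<1}" "u \<in> {0<..<1}" "\<gamma> t = \<gamma> u"
    then have "t = u \<or> t = 0 \<and> u = 1 \<or> t = 1 \<and> u = 0"
      using \<open>simple_path \<gamma>\<close> unfolding simple_path_def loop_free_def by (meson atLeastAtMost_iff
        greaterThanLessThan_iff less_imp_le)
    then show "t = u" using tu by auto
  qed
  have imS: "\<gamma> t \<in> S" if "t \<in> {0..1}" for t
    using that im frontier_subset_closed[OF compact_imp_closed[OF \<open>compact S\<close>]]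
    unfolding path_image_def by blast
  let ?f = "\<lambda>t. N (\<gamma> t) * snd (\<gamma>' t)"
  let ?J = "jump_density \<delta> S N"
  let ?P = "\<lambda>x. {y. (x, y) \<in> path_image \<gamma>}"
  let ?T = "\<lambda>x. {t \<in> {0..1}. fst (\<gamma> t) = x} - {t \<in> {0..1}. snd (\<gamma> t) \<in> Y} - E'"
  have compP: "compact (?P x)" for x
    by (intro compact_column compact_path_image) (use \<open>simple_path \<gamma>\<close> in \<open>simp add: simple_path_def\<close>)
  have part: "(?f has_integral s * integral (?P x) (?J x)) (?T x)" if "x \<in> X" for x
  proof -
    let ?g = "\<lambda>t. snd (\<gamma> t)"
    have contg: "continuous_on {0..1} ?g" "continuous_on {0..1} (\<lambda>t. fst (\<gamma> t))"
      using cont by (auto intro!: continuous_intros)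
    have cl: "closed {t \<in> {0..1}. fst (\<gamma> t) \<in> {x}}" "closed {t \<in> {0..1}. ?g t \<in> Y}"
      using continuous_closed_preimage[OF contg(2), of "{x}"]
        continuous_closed_preimage[OF contg(1), of Y] finite_imp_closed[OF fin(2)]
      by (simp_all add: vimage_def Int_def)
    have meas: "?T x \<in> sets lebesgue"
      using cl finite_imp_closed[OF E'(1)]
      by (intro sets.Diff) (simp_all add: lebesgue_closedin[of UNIV, simplified] borel_closed)
    \<comment> \<open>Up to finitely many heights, the part of the line on the path is traversed at the chosen times.\<close>
    have gT: "?g ` ?T x \<subseteq> ?P x" "?P x - (Y \<union> ?g ` E') \<subseteq> ?g ` ?T x"
    proof -
      show "?g ` ?T x \<subseteq> ?P x" by (auto simp: path_image_def intro!: image_eqI prod_eqI)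
      show "?P x - (Y \<union> ?g ` E') \<subseteq> ?g ` ?T x"
      proof
        fix y assume y: "y \<in> ?P x - (Y \<union> ?g ` E')"
        then obtain t where t: "t \<in> {0..1}" "\<gamma> t = (x, y)" unfolding path_image_def by auto
        then have "t \<notin> E'" using y by force
        then show "y \<in> ?g ` ?T x" using t y by (intro image_eqI[of _ _ t]) auto
      qed
    qed
    have JUN: "?J x absolutely_integrable_on UNIV"
      using integrable_jump_density[OF \<open>compact S\<close> N, of \<delta> x]
      by (simp add: set_integrable_def integrable_completion)
    have negl: "negligible (sym_diff (?g ` ?T x) (?P x))"
      by (rule negligible_subset[of "Y \<union> ?g ` E'"]) (use gT E'(1) fin in \<open>auto intro: negligible_finite\<close>)
    have Jabs: "?J x absolutely_integrable_on ?P x"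
      using set_integrable_subset[OF JUN, of "?P x"] compact_imp_closed[OF compP]
      by (simp add: borel_closed)
    then have Jabs': "?J x absolutely_integrable_on ?g ` ?T x"
      by (rule absolutely_integrable_spike_set) (rule negligible_subset[OF negl], blast)+
    have J_eq: "integral (?g ` ?T x) (?J x) = integral (?P x) (?J x)"
      by (intro integral_spike_set) (rule negligible_subset[OF negl], blast)+
    have injg: "inj_on ?g (?T x)"
    proof (rule inj_onI)
      fix t u assume tu: "t \<in> ?T x" "u \<in> ?T x" "?g t = ?g u"
      then have "\<gamma> t = \<gamma> u" by (simp add: prod_eq_iff)
      then show "t = u" using inj tu E01[of t] E01[of u] by (simp add: inj_on_def)
    qed
    have derg: "(?g has_real_derivative snd (\<gamma>' t)) (at t within ?T x)" if "t \<in> ?T x" for t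
      using bounded_linear.has_vector_derivative[OF bounded_linear_snd der[of t]] that
      by (auto simp: has_real_derivative_iff_has_vector_derivative intro: has_vector_derivative_at_within)
    have "(\<lambda>t. \<bar>snd (\<gamma>' t)\<bar> * ?J x (?g t)) absolutely_integrable_on ?T x \<and>
        integral (?T x) (\<lambda>t. \<bar>snd (\<gamma>' t)\<bar> * ?J x (?g t)) = integral (?P x) (?J x)"
      using has_absolute_integral_change_of_variables_1'[OF meas derg injg,
          of "?J x" "integral (?P x) (?J x)"] Jabs' J_eq by simp
    then have "((\<lambda>t. \<bar>snd (\<gamma>' t)\<bar> * ?J x (?g t)) has_integral integral (?P x) (?J x)) (?T x)"
      by (simp add: has_integral_iff set_lebesgue_integral_eq_integral(1))
    then have "((\<lambda>t. s * (\<bar>snd (\<gamma>' t)\<bar> * ?J x (?g t))) has_integral s * integral (?P x) (?J x)) (?T x)"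
      by (rule has_integral_mult_right)
    then show ?thesis
    proof (rule has_integral_eq[rotated])
      fix t assume t: "t \<in> ?T x"
      have "snd (\<gamma>' t) = s * (\<bar>snd (\<gamma>' t)\<bar> * jump \<delta> S (fst (\<gamma> t)) (snd (\<gamma> t)))"
        using t E01[of t] isolated_of_separated[OF \<delta> that] der[of t]
        by (intro velocity_along_vertical_edge[OF fin fr \<delta>(1) _ _ _ im side s]) auto
      moreover have "(x, ?g t) = \<gamma> t" using t by (auto intro: prod_eqI)
      ultimately show "s * (\<bar>snd (\<gamma>' t)\<bar> * ?J x (?g t)) = ?f t"
        using imS[of t] t by (auto simp: jump_density_def)
    qed
  qed
  let ?c = "\<lambda>x t. if t \<in> ?T x then ?f t else 0"
  have "(?c x has_integral s * integral (?P x) (?J x)) {0..1}" if "x \<in> X" for x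
    using part[OF that] by (subst has_integral_restrict) auto
  then have sum_int: "((\<lambda>t. \<Sum>x\<in>X. ?c x t) has_integral (\<Sum>x\<in>X. s * integral (?P x) (?J x))) {0..1}"
    by (intro has_integral_sum fin) auto
  \<comment> \<open>By injectivity the path meets the grid points \<open>X \<times> Y\<close> only finitely often.\<close>
  have fin_bad: "finite (E' \<union> ({0<..<1} \<inter> \<gamma> -` (X \<times> Y)))"
    using E'(1) fin finite_vimage_IntI[OF _ inj, of "X \<times> Y"] by (simp add: Int_commute)
  have good: "?f t = (\<Sum>x\<in>X. ?c x t)"
    if "t \<in> {0..1} - (E' \<union> ({0<..<1} \<inter> \<gamma> -` (X \<times> Y)))" for t
  proof (cases "fst (\<gamma> t) \<in> X")
    case True
    have "snd (\<gamma> t) \<notin> Y" using that True E01[of t] by (cases "\<gamma> t") auto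
    then have "(\<Sum>x\<in>X. ?c x t) = (\<Sum>x\<in>X. if x = fst (\<gamma> t) then ?f t else 0)"
      using that by (intro sum.cong) auto
    then show ?thesis using True fin by simp
  next
    case False
    then have "snd (\<gamma>' t) = 0"
      using that E01[of t] der[of t]
      by (intro velocity_along_horizontal_edge[OF fin fr _ _ im]) auto
    moreover from this have "(\<Sum>x\<in>X. ?c x t) = 0" by (intro sum.neutral) simp
    ultimately show ?thesis by simp
  qed
  have "(?f has_integral (\<Sum>x\<in>X. s * integral (?P x) (?J x))) {0..1}"
    by (rule has_integral_spike_finite[OF fin_bad good sum_int])
  then show ?thesis by (simp add: sum_distrib_left)
qed

text \<open>Both sides equal \<open>s\<close> times the sum over \<open>x \<in> X\<close> of the integrals of the jump densities: the paths
  together cover the frontier once, and at heights outside \<open>Y\<close> the jump vanishes off the frontier.\<close>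

lemma sum_integrals_along_boundary:
  fixes \<phi> :: "'c \<Rightarrow> real \<Rightarrow> real \<times> real"
  assumes "compact S" and fin: "finite X" "finite Y"
    and fr: "frontier S \<subseteq> X \<times> UNIV \<union> UNIV \<times> Y"
    and N: "continuous_on S N" and D: "continuous_on S D"
    and deriv: "\<And>p. p \<in> interior S \<Longrightarrow>
      ((\<lambda>x. N (x, snd p)) has_vector_derivative D p) (at (fst p))"
    and "finite I" and disj: "disjoint_family_on (\<lambda>c. path_image (\<phi> c)) I"
    and cover: "(\<Union>c\<in>I. path_image (\<phi> c)) = frontier S"
    and simple: "\<And>c. c \<in> I \<Longrightarrow> simple_path (\<phi> c)"
    and E: "\<And>c. c \<in> I \<Longrightarrow> finite (E c)"
    and der: "\<And>c t. c \<in> I \<Longrightarrow> t \<in> {0..1} - E c \<Longrightarrow> (\<phi> c has_vector_derivative \<phi>' c t) (at t)"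
    and side: "\<And>c. c \<in> I \<Longrightarrow> keeps_on_side s S (\<phi> c)" and s: "s \<in> {1, -1}"
  shows "\<And>c. c \<in> I \<Longrightarrow> (\<lambda>t. N (\<phi> c t) * snd (\<phi>' c t)) integrable_on {0..1}"
    and "(\<Sum>c\<in>I. integral {0..1} (\<lambda>t. N (\<phi> c t) * snd (\<phi>' c t))) = s * integral S D"
proof -
  obtain \<delta> where \<delta>: "0 < \<delta>" "\<And>x x'. x \<in> X \<Longrightarrow> x' \<in> X \<Longrightarrow> x < x' \<Longrightarrow> x + 2 * \<delta> < x'"
    using finite_set_separated[OF fin(1)] by metis
  let ?J = "jump_density \<delta> S N"
  let ?P = "\<lambda>c x. {y. (x, y) \<in> path_image (\<phi> c)}"
  have path: "((\<lambda>t. N (\<phi> c t) * snd (\<phi>' c t)) has_integral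
      s * (\<Sum>x\<in>X. integral (?P c x) (?J x))) {0..1}" if "c \<in> I" for c
    using cover that
    by (intro has_integral_along_path[OF \<open>compact S\<close> fin fr \<delta> N simple[OF that] E[OF that] der[OF that]
          _ side[OF that] s]) auto
  show "(\<lambda>t. N (\<phi> c t) * snd (\<phi>' c t)) integrable_on {0..1}" if "c \<in> I" for c
    using path[OF that] by blast
  have column: "(\<Sum>c\<in>I. integral (?P c x) (?J x)) = integral UNIV (?J x)" if "x \<in> X" for x
  proof -
    have JUN: "?J x absolutely_integrable_on UNIV"
      using integrable_jump_density[OF \<open>compact S\<close> N, of \<delta> x]
      by (simp add: set_integrable_def integrable_completion)
    have "(?J x has_integral integral (?P c x) (?J x)) (?P c x)" if "c \<in> I" for c
    proof -
      have "compact (?P c x)"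
        using simple[OF that] by (intro compact_column compact_path_image) (simp add: simple_path_def)
      then have "?J x absolutely_integrable_on ?P c x"
        by (intro set_integrable_subset[OF JUN]) (simp_all add: borel_compact)
      then show ?thesis by (intro integrable_integral set_lebesgue_integral_eq_integral(1))
    qed
    moreover have "pairwise (\<lambda>c c'. negligible (?P c x \<inter> ?P c' x)) I"
    proof (rule pairwiseI)
      fix c c' assume "c \<in> I" "c' \<in> I" "c \<noteq> c'"
      then have "path_image (\<phi> c) \<inter> path_image (\<phi> c') = {}"
        using disj by (simp add: disjoint_family_on_def)
      then have "?P c x \<inter> ?P c' x = {}" by auto
      then show "negligible (?P c x \<inter> ?P c' x)" by simp
    qed
    ultimately have "(?J x has_integral (\<Sum>c\<in>I. integral (?P c x) (?J x))) (\<Union>c\<in>I. ?P c x)"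
      by (rule has_integral_UN[OF \<open>finite I\<close>])
    also have "(\<Union>c\<in>I. ?P c x) = {y. (x, y) \<in> frontier S}" using cover by auto
    finally have "((\<lambda>y. if y \<in> {y. (x, y) \<in> frontier S} then ?J x y else 0) has_integral
        (\<Sum>c\<in>I. integral (?P c x) (?J x))) UNIV"
      by (subst has_integral_restrict) auto
    then have "(?J x has_integral (\<Sum>c\<in>I. integral (?P c x) (?J x))) UNIV"
    proof (rule has_integral_spike_finite[OF fin(2), rotated])
      fix y assume "y \<in> UNIV - Y"
      then have "?J x y = 0" if "(x, y) \<notin> frontier S"
        using jump_eq_0[OF compact_imp_closed[OF \<open>compact S\<close>] fr _ that \<delta>(1)]
          isolated_of_separated[OF \<delta> \<open>x \<in> X\<close>] by (simp add: jump_density_def)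
      then show "?J x y = (if y \<in> {y. (x, y) \<in> frontier S} then ?J x y else 0)" by simp
    qed
    then show ?thesis by (simp add: integral_unique)
  qed
  have "(\<Sum>c\<in>I. integral {0..1} (\<lambda>t. N (\<phi> c t) * snd (\<phi>' c t)))
      = (\<Sum>c\<in>I. s * (\<Sum>x\<in>X. integral (?P c x) (?J x)))"
    by (intro sum.cong refl integral_unique path)
  also have "\<dots> = s * (\<Sum>x\<in>X. \<Sum>c\<in>I. integral (?P c x) (?J x))"
    by (subst sum.swap) (simp add: sum_distrib_left)
  also have "\<dots> = s * (\<Sum>x\<in>X. integral UNIV (?J x))"
    using column by simp
  also have "(\<Sum>x\<in>X. integral UNIV (?J x)) = integral S D"
    by (rule integral_eq_sum_integral_jump_density[OF \<open>compact S\<close> fin fr \<delta> N D deriv, symmetric])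
  finally show "(\<Sum>c\<in>I. integral {0..1} (\<lambda>t. N (\<phi> c t) * snd (\<phi>' c t))) = s * integral S D" .
qed

section \<open>Exchanging the coordinates\<close>

lemma linear_swap: "linear (prod.swap :: real \<times> real \<Rightarrow> real \<times> real)"
  by (rule linearI) (auto simp: prod.swap_def)

lemma integral_swap_image:
  fixes D :: "real \<times> real \<Rightarrow> real"
  assumes "compact S" "continuous_on S D"
  shows "integral (prod.swap ` S) (\<lambda>p. D (prod.swap p)) = integral S D"
proof -
  let ?D = "\<lambda>p. indicator S p *\<^sub>R D p"
  have int: "integrable lborel ?D" by (rule borel_integrable_compact[OF assms])
  have uncurry: "(\<lambda>(x, y). ?D (y, x)) = (\<lambda>p. ?D (prod.swap p))" by (auto simp: prod.swap_def)
  have int': "integrable lborel (\<lambda>p. ?D (prod.swap p))"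
    using lborel_pair.integrable_product_swap[of ?D] int unfolding lborel_prod uncurry by blast
  have "integral (prod.swap ` S) (\<lambda>p. D (prod.swap p)) = integral UNIV (\<lambda>p. ?D (prod.swap p))"
    by (subst integral_restrict_UNIV[symmetric])
      (auto simp: indicator_def intro!: arg_cong[of _ _ "integral UNIV"])
  also have "\<dots> = (LINT p|lborel. ?D (prod.swap p))" by (rule integral_lborel[OF int'])
  also have "\<dots> = (LINT p|lborel. ?D p)"
    using lborel_pair.integral_product_swap[of ?D] borel_measurable_integrable[OF int]
    unfolding lborel_prod uncurry by blast
  also have "\<dots> = integral UNIV ?D" by (rule integral_lborel[OF int, symmetric])
  also have "\<dots> = integral S D"
    by (subst integral_restrict_UNIV[symmetric])
      (auto simp: indicator_def intro!: arg_cong[of _ _ "integral UNIV"])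
  finally show ?thesis .
qed

text \<open>The quarter turn anticommutes with the exchange of coordinates.\<close>

lemma keeps_on_side_swap:
  assumes "keeps_on_side s S \<gamma>"
  shows "keeps_on_side (- s) (prod.swap ` S) (prod.swap \<circ> \<gamma>)"
  unfolding keeps_on_side_def
proof (intro ballI allI impI, elim conjE)
  fix t :: real and v
  assume t: "t \<in> {0<..<1}" and v: "((prod.swap \<circ> \<gamma>) has_vector_derivative v) (at t)" "v \<noteq> 0"
  have bl: "bounded_linear (prod.swap :: real \<times> real \<Rightarrow> real \<times> real)"
    using linear_swap by (simp add: linear_conv_bounded_linear)
  have "(\<gamma> has_vector_derivative prod.swap v) (at t)"
    using bounded_linear.has_vector_derivative[OF bl v(1)] by (simp add: comp_def)
  moreover have "prod.swap v \<noteq> 0" using v(2) by (cases v) (auto simp: zero_prod_def)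
  ultimately have "\<forall>\<^sub>F e in at_right 0. \<gamma> t + (s * e) *\<^sub>R rotate_left (prod.swap v) \<in> S
      \<and> \<gamma> t - (s * e) *\<^sub>R rotate_left (prod.swap v) \<notin> S"
    using assms t unfolding keeps_on_side_def by blast
  then show "\<forall>\<^sub>F e in at_right 0.
      (prod.swap \<circ> \<gamma>) t + (- s * e) *\<^sub>R rotate_left v \<in> prod.swap ` S \<and>
      (prod.swap \<circ> \<gamma>) t - (- s * e) *\<^sub>R rotate_left v \<notin> prod.swap ` S"
  proof eventually_elim
    case (elim e)
    have mem: "p \<in> prod.swap ` S \<longleftrightarrow> prod.swap p \<in> S" for p by force
    have "prod.swap ((prod.swap \<circ> \<gamma>) t + (- s * e) *\<^sub>R rotate_left v)
        = \<gamma> t + (s * e) *\<^sub>R rotate_left (prod.swap v)"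
      "prod.swap ((prod.swap \<circ> \<gamma>) t - (- s * e) *\<^sub>R rotate_left v)
        = \<gamma> t - (s * e) *\<^sub>R rotate_left (prod.swap v)"
      by (simp_all add: prod_eq_iff rotate_left_def)
    then show ?case using elim by (simp only: mem) blast
  qed
qed

lemma interior_swap_image:
  fixes S :: "(real \<times> real) set"
  shows "interior (prod.swap ` S) = prod.swap ` interior S"
  by (rule interior_bijective_linear_image[OF linear_swap]) (simp add: bij_swap)

lemma frontier_swap_image:
  fixes S :: "(real \<times> real) set"
  shows "frontier (prod.swap ` S) = prod.swap ` frontier S"
proof -
  have sw: "inj (prod.swap :: real \<times> real \<Rightarrow> real \<times> real)" by simp
  show ?thesis
    unfolding frontier_def interior_swap_image closure_injective_linear_image[OF linear_swap sw, symmetric]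
    by (simp add: image_set_diff[OF sw])
qed

section \<open>Unions of segments and negligible sets\<close>

lemma segments_in_finitely_many_lines:
  assumes "finite \<S>" "\<And>s. s \<in> \<S> \<Longrightarrow> horizontal_or_vertical_segment s"
  obtains X Y where "finite X" "finite Y" "\<Union>\<S> \<subseteq> X \<times> UNIV \<union> UNIV \<times> Y"
proof -
  have "\<exists>x y. s \<subseteq> {x} \<times> UNIV \<or> s \<subseteq> UNIV \<times> {y}" if s: "s \<in> \<S>" for s
  proof -
    obtain a b where ab: "fst a = fst b \<or> snd a = snd b" "s = closed_segment a b"
      using assms(2)[OF s] unfolding horizontal_or_vertical_segment_def by blast
    have "p \<in> {fst a} \<times> UNIV" if "fst a = fst b" "p \<in> s" for p
      using that ab(2) by (cases a; cases b; cases p) (auto dest!: closed_segment_PairD)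
    moreover have "p \<in> UNIV \<times> {snd a}" if "snd a = snd b" "p \<in> s" for p
      using that ab(2) by (cases a; cases b; cases p) (auto dest!: closed_segment_PairD)
    ultimately show ?thesis using ab(1) by blast
  qed
  then obtain x y where "\<And>s. s \<in> \<S> \<Longrightarrow> s \<subseteq> {x s} \<times> UNIV \<or> s \<subseteq> UNIV \<times> {y s}"
    by metis
  then have "\<Union>\<S> \<subseteq> x ` \<S> \<times> UNIV \<union> UNIV \<times> y ` \<S>" by fast
  then show thesis using assms(1) by (intro that[of "x ` \<S>" "y ` \<S>"]) auto
qed

text \<open>Every component contains one of the connected sets, and it is the component of any point of
  that set.\<close>

lemma finite_components_Union_connected:
  assumes "finite \<S>" "\<And>s. s \<in> \<S> \<Longrightarrow> connected s"
  shows "finite (components (\<Union>\<S>))"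
proof (rule finite_subset)
  show "components (\<Union>\<S>) \<subseteq> (\<lambda>s. connected_component_set (\<Union>\<S>) (SOME p. p \<in> s)) ` \<S>"
  proof
    fix C assume C: "C \<in> components (\<Union>\<S>)"
    then obtain p where p: "p \<in> \<Union>\<S>" "C = connected_component_set (\<Union>\<S>) p"
      by (auto simp: components_def)
    then obtain s where s: "s \<in> \<S>" "p \<in> s" by auto
    then have "(SOME p. p \<in> s) \<in> s" by (metis someI)
    then have "(SOME p. p \<in> s) \<in> C"
      using connected_component_maximal[OF s(2) assms(2)[OF s(1)], of "\<Union>\<S>"] s(1) p(2) by blast
    then have "C = connected_component_set (\<Union>\<S>) (SOME p. p \<in> s)"
      using connected_component_eq p(2) by metis
    then show "C \<in> (\<lambda>s. connected_component_set (\<Union>\<S>) (SOME p. p \<in> s)) ` \<S>"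
      using s(1) by blast
  qed
qed (use assms(1) in simp)

lemma integrable_on_compact_if_continuous:
  fixes f :: "real \<times> real \<Rightarrow> real"
  assumes "compact S" "continuous_on S f"
  shows "f integrable_on S"
proof -
  have "(\<lambda>p. indicator S p *\<^sub>R f p) integrable_on UNIV"
    by (rule integrable_on_lborel[OF borel_integrable_compact[OF assms]])
  then have "(\<lambda>p. if p \<in> S then f p else 0) integrable_on UNIV"
    by (rule integrable_eq) (simp add: indicator_def)
  then show ?thesis by (simp only: integrable_restrict_UNIV)
qed

lemma negligible_vertical_line:
  fixes x :: real
  shows "negligible ({x} \<times> (UNIV :: real set))"
proof -
  have "{x} \<times> (UNIV :: real set) = {p. p \<bullet> (1, 0) = x}" by (auto simp: inner_prod_def)
  moreover have "(1, 0) \<in> (Basis :: (real \<times> real) set)" by (simp add: Basis_prod_def)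
  ultimately show ?thesis using negligible_standard_hyperplane[of "(1, 0) :: real \<times> real"] by simp
qed

lemma negligible_horizontal_line:
  fixes y :: real
  shows "negligible ((UNIV :: real set) \<times> {y})"
proof -
  have "(UNIV :: real set) \<times> {y} = {p. p \<bullet> (0, 1) = y}" by (auto simp: inner_prod_def)
  moreover have "(0, 1) \<in> (Basis :: (real \<times> real) set)" by (simp add: Basis_prod_def)
  ultimately show ?thesis using negligible_standard_hyperplane[of "(0, 1) :: real \<times> real"] by simp
qed

lemma negligible_finitely_many_lines:
  assumes "finite X" "finite Y"
  shows "negligible (X \<times> UNIV \<union> UNIV \<times> Y :: (real \<times> real) set)"
proof -
  have "X \<times> (UNIV :: real set) = (\<Union>x\<in>X. {x} \<times> UNIV)"
    "(UNIV :: real set) \<times> Y = (\<Union>y\<in>Y. UNIV \<times> {y})" by auto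
  moreover have "negligible (\<Union>x\<in>X. {x} \<times> (UNIV :: real set))"
    using assms negligible_vertical_line by (intro negligible_Union) auto
  moreover have "negligible (\<Union>y\<in>Y. (UNIV :: real set) \<times> {y})"
    using assms negligible_horizontal_line by (intro negligible_Union) auto
  ultimately show ?thesis by (simp only: negligible_Un)
qed

section \<open>Derivatives along rows and columns\<close>

lemma interior_row: "p \<in> interior S \<Longrightarrow> fst p \<in> interior {x. (x, snd p) \<in> S}"
  for p :: "real \<times> real"
proof -
  assume p: "p \<in> interior S"
  have "open ((\<lambda>x. (x, snd p)) -` interior S)" by (intro open_vimage continuous_intros) auto
  moreover have "(\<lambda>x. (x, snd p)) -` interior S \<subseteq> {x. (x, snd p) \<in> S}" using interior_subset by auto
  moreover have "fst p \<in> (\<lambda>x. (x, snd p)) -` interior S" using p by simp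
  ultimately show ?thesis by (meson interiorI)
qed

lemma interior_column: "p \<in> interior S \<Longrightarrow> snd p \<in> interior {y. (fst p, y) \<in> S}"
  for p :: "real \<times> real"
proof -
  assume p: "p \<in> interior S"
  have "open ((\<lambda>y. (fst p, y)) -` interior S)" by (intro open_vimage continuous_intros) auto
  moreover have "(\<lambda>y. (fst p, y)) -` interior S \<subseteq> {y. (fst p, y) \<in> S}" using interior_subset by auto
  moreover have "snd p \<in> (\<lambda>y. (fst p, y)) -` interior S" using p by simp
  ultimately show ?thesis by (meson interiorI)
qed

lemma has_vector_derivative_along_row:
  fixes F :: "real \<times> real \<Rightarrow> real \<times> real"
  assumes "(F has_derivative F') (at p)"
  shows "((\<lambda>x. F (x, snd p)) has_vector_derivative F' (1, 0)) (at (fst p))"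
proof -
  have "((\<lambda>x. (x, snd p)) has_vector_derivative (1, 0)) (at (fst p))"
    by (intro has_vector_derivative_Pair has_vector_derivative_id has_vector_derivative_const)
  moreover have "(F has_derivative F') (at (fst p, snd p) within (\<lambda>x. (x, snd p)) ` UNIV)"
    using assms by (simp add: has_derivative_at_withinI)
  ultimately show ?thesis
    using vector_derivative_diff_chain_within[of "\<lambda>x. (x, snd p)" "(1, 0)" "fst p" UNIV F F']
    by (simp add: comp_def)
qed

lemma has_vector_derivative_along_column:
  fixes F :: "real \<times> real \<Rightarrow> real \<times> real"
  assumes "(F has_derivative F') (at p)"
  shows "((\<lambda>y. F (fst p, y)) has_vector_derivative F' (0, 1)) (at (snd p))"
proof -
  have "((\<lambda>y. (fst p, y)) has_vector_derivative (0, 1)) (at (snd p))"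
    by (intro has_vector_derivative_Pair has_vector_derivative_id has_vector_derivative_const)
  moreover have "(F has_derivative F') (at (fst p, snd p) within (\<lambda>y. (fst p, y)) ` UNIV)"
    using assms by (simp add: has_derivative_at_withinI)
  ultimately show ?thesis
    using vector_derivative_diff_chain_within[of "\<lambda>y. (fst p, y)" "(0, 1)" "snd p" UNIV F F']
    by (simp add: comp_def)
qed

section \<open>Green's theorem\<close>

theorem theorem2p6:
  fixes S :: "(real \<times> real) set"
    and F :: "real \<times> real \<Rightarrow> real \<times> real"
    and \<phi> :: "(real \<times> real) set \<Rightarrow> real \<Rightarrow> real \<times> real"
  assumes "compact S"
    and "surface_with_boundary S"
    and "\<exists>\<S>. finite \<S> \<and> (\<forall>s\<in>\<S>. horizontal_or_vertical_segment s) \<and> surface_boundary S = \<Union>\<S>"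
    and "C1_vector_field S F"
    and "\<And>C. C \<in> components (surface_boundary S) \<Longrightarrow> oriented_parametrization S C (\<phi> C)"
  shows "(\<Sum>C\<in>components (surface_boundary S). line_integral F (\<phi> C)) = integral S (scurl S F)"
proof -
  have "closed S" using \<open>compact S\<close> by (rule compact_imp_closed)
  have fr_eq: "surface_boundary S = frontier S"
    by (rule surface_boundary_eq_frontier[OF \<open>closed S\<close> assms(2)])
  obtain \<S> where \<S>: "finite \<S>" "\<And>s. s \<in> \<S> \<Longrightarrow> horizontal_or_vertical_segment s" "frontier S = \<Union>\<S>"
    using assms(3) fr_eq by auto
  obtain X Y where fin: "finite X" "finite Y" and fr: "frontier S \<subseteq> X \<times> UNIV \<union> UNIV \<times> Y"
    using segments_in_finitely_many_lines[OF \<S>(1,2)] \<S>(3) by metis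
  let ?I = "components (frontier S)"
  have "connected s" if "s \<in> \<S>" for s
    using \<S>(2)[OF that] by (auto simp: horizontal_or_vertical_segment_def)
  then have finI: "finite ?I" unfolding \<S>(3) by (rule finite_components_Union_connected[OF \<S>(1)])
  have par: "oriented_parametrization S C (\<phi> C)" if "C \<in> ?I" for C
    using assms(5) that fr_eq by simp
  have im: "path_image (\<phi> C) = C" and simple: "simple_path (\<phi> C)"
    and side: "keeps_on_side 1 S (\<phi> C)" if "C \<in> ?I" for C
    using par[OF that] by (auto simp: oriented_parametrization_def keeps_on_left_def keeps_on_side_def)
  have "\<exists>E. finite E \<and> (\<forall>t\<in>{0..1} - E. \<phi> C differentiable at t)" if "C \<in> ?I" for C
    using par[OF that]
    by (auto simp: oriented_parametrization_def valid_path_def piecewise_C1_differentiable_on_def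
        C1_differentiable_on_eq)
  then obtain E where E: "\<And>C. C \<in> ?I \<Longrightarrow> finite (E C)"
    and diff: "\<And>C t. C \<in> ?I \<Longrightarrow> t \<in> {0..1} - E C \<Longrightarrow> \<phi> C differentiable at t"
    by metis
  let ?v = "\<lambda>C t. vector_derivative (\<phi> C) (at t)"
  have der: "(\<phi> C has_vector_derivative ?v C t) (at t)" if "C \<in> ?I" "t \<in> {0..1} - E C" for C t
    using diff[OF that] by (simp add: vector_derivative_works)
  have disj: "disjoint_family_on (\<lambda>C. path_image (\<phi> C)) ?I"
    by (simp add: disjoint_family_on_def im components_nonoverlap)
  have cover: "(\<Union>C\<in>?I. path_image (\<phi> C)) = frontier S"
    using im Union_components[of "frontier S"] by auto

  obtain F' :: "real \<times> real \<Rightarrow> (real \<times> real) \<Rightarrow>\<^sub>L (real \<times> real)"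
    where F': "\<And>p. p \<in> S \<Longrightarrow> (F has_derivative blinfun_apply (F' p)) (at p within S)"
      and contF': "continuous_on S F'"
    using assms(4) unfolding C1_vector_field_def by blast
  have contF: "continuous_on S F"
    using F' by (auto simp: continuous_on_eq_continuous_within intro: has_derivative_continuous)
  have F'_int: "(F has_derivative blinfun_apply (F' p)) (at p)" if "p \<in> interior S" for p
    using F'[OF subsetD[OF interior_subset that]] unfolding at_within_interior[OF that] .
  let ?N\<^sub>x = "\<lambda>p. snd (F' p (1, 0))" and ?M\<^sub>y = "\<lambda>p. fst (F' p (0, 1))"
  have cont_part: "continuous_on S ?N\<^sub>x" "continuous_on S ?M\<^sub>y"
    using contF' by (auto intro!: continuous_intros)
  have N_x: "((\<lambda>x. snd (F (x, snd p))) has_vector_derivative ?N\<^sub>x p) (at (fst p))"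
    if "p \<in> interior S" for p
    using has_vector_derivative_along_row[OF F'_int[OF that]]
    by (rule bounded_linear.has_vector_derivative[OF bounded_linear_snd])
  have M_y: "((\<lambda>y. fst (F (fst p, y))) has_vector_derivative ?M\<^sub>y p) (at (snd p))"
    if "p \<in> interior S" for p
    using has_vector_derivative_along_column[OF F'_int[OF that]]
    by (rule bounded_linear.has_vector_derivative[OF bounded_linear_fst])

  have N_int: "\<And>C. C \<in> ?I \<Longrightarrow> (\<lambda>t. snd (F (\<phi> C t)) * snd (?v C t)) integrable_on {0..1}"
    and N_sum: "(\<Sum>C\<in>?I. integral {0..1} (\<lambda>t. snd (F (\<phi> C t)) * snd (?v C t))) = 1 * integral S ?N\<^sub>x"
    using sum_integrals_along_boundary[of S X Y "\<lambda>p. snd (F p)" ?N\<^sub>x ?I \<phi> E ?v 1,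
        OF \<open>compact S\<close> fin fr continuous_on_snd[OF contF] cont_part(1) N_x finI disj cover simple E der side]
    by auto

  \<comment> \<open>The part with \<open>M\<close> is the part with \<open>N\<close> for the reflected surface, whose boundary keeps it on the right.\<close>
  let ?S' = "prod.swap ` S" and ?\<psi> = "\<lambda>C. prod.swap \<circ> \<phi> C"
  have bl: "bounded_linear (prod.swap :: real \<times> real \<Rightarrow> real \<times> real)"
    using linear_swap by (simp add: linear_conv_bounded_linear)
  have cont_swap: "continuous_on A (prod.swap :: real \<times> real \<Rightarrow> real \<times> real)" for A
    by (rule linear_continuous_on[OF bl])
  have compact': "compact ?S'" by (rule compact_continuous_image[OF cont_swap \<open>compact S\<close>])
  have fr': "frontier ?S' \<subseteq> Y \<times> UNIV \<union> UNIV \<times> X"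
    unfolding frontier_swap_image using fr by auto
  have contM: "continuous_on ?S' (\<lambda>p. fst (F (prod.swap p)))"
    by (rule continuous_on_compose2[OF continuous_on_fst[OF contF] cont_swap]) auto
  have contM': "continuous_on ?S' (\<lambda>p. ?M\<^sub>y (prod.swap p))"
    by (rule continuous_on_compose2[OF cont_part(2) cont_swap]) auto
  have derM: "((\<lambda>x. fst (F (prod.swap (x, snd p)))) has_vector_derivative ?M\<^sub>y (prod.swap p)) (at (fst p))"
    if "p \<in> interior ?S'" for p
    using M_y[of "prod.swap p"] that by (auto simp: interior_swap_image)
  have image': "path_image (?\<psi> C) = prod.swap ` path_image (\<phi> C)" for C
    by (simp add: path_image_compose)
  have disj': "disjoint_family_on (\<lambda>C. path_image (?\<psi> C)) ?I"
    using disj unfolding image' by (fastforce simp: disjoint_family_on_def)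
  have cover': "(\<Union>C\<in>?I. path_image (?\<psi> C)) = frontier ?S'"
    unfolding image' frontier_swap_image image_UN[symmetric] cover ..
  have simple': "simple_path (?\<psi> C)" if "C \<in> ?I" for C
    using simple[OF that] by (simp add: simple_path_linear_image_eq[OF linear_swap])
  have der': "(?\<psi> C has_vector_derivative prod.swap (?v C t)) (at t)"
    if "C \<in> ?I" "t \<in> {0..1} - E C" for C t
    using bounded_linear.has_vector_derivative[OF bl der[OF that]] by (simp add: comp_def)
  have side': "keeps_on_side (- 1) ?S' (?\<psi> C)" if "C \<in> ?I" for C
    by (rule keeps_on_side_swap[OF side[OF that]])
  have M_int: "\<And>C. C \<in> ?I \<Longrightarrow> (\<lambda>t. fst (F (\<phi> C t)) * fst (?v C t)) integrable_on {0..1}"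
    and M_sum: "(\<Sum>C\<in>?I. integral {0..1} (\<lambda>t. fst (F (\<phi> C t)) * fst (?v C t))) = - integral S ?M\<^sub>y"
    using sum_integrals_along_boundary[of ?S' Y X "\<lambda>p. fst (F (prod.swap p))" "\<lambda>p. ?M\<^sub>y (prod.swap p)"
        ?I ?\<psi> E "\<lambda>C t. prod.swap (?v C t)" "- 1",
        OF compact' fin(2,1) fr' contM contM' derM finI disj' cover' simple' E der' side']
      integral_swap_image[OF \<open>compact S\<close> cont_part(2)]
    by auto

  have "(\<Sum>C\<in>?I. line_integral F (\<phi> C)) = (\<Sum>C\<in>?I. integral {0..1} (\<lambda>t. fst (F (\<phi> C t)) * fst (?v C t))
      + integral {0..1} (\<lambda>t. snd (F (\<phi> C t)) * snd (?v C t)))"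
    using M_int N_int
    by (intro sum.cong refl) (simp add: line_integral_def inner_prod_def integral_add)
  also have "\<dots> = integral S ?N\<^sub>x - integral S ?M\<^sub>y"
    using N_sum M_sum by (simp add: sum.distrib)
  also have "\<dots> = integral S (\<lambda>p. ?N\<^sub>x p - ?M\<^sub>y p)"
    by (intro integral_diff[symmetric] integrable_on_compact_if_continuous[OF \<open>compact S\<close>] cont_part)
  also have "\<dots> = integral S (scurl S F)"
  proof (rule integral_spike)
    show "negligible (frontier S)"
      using negligible_finitely_many_lines[OF fin] fr by (rule negligible_subset)
    fix p assume "p \<in> S - frontier S"
    then have p: "p \<in> interior S" using \<open>closed S\<close> by (auto simp: frontier_def)
    have "partial_x S (\<lambda>q. snd (F q)) p = ?N\<^sub>x p"
      unfolding partial_x_def at_within_interior[OF interior_row[OF p]]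
      by (rule vector_derivative_at[OF N_x[OF p]])
    moreover have "partial_y S (\<lambda>q. fst (F q)) p = ?M\<^sub>y p"
      unfolding partial_y_def at_within_interior[OF interior_column[OF p]]
      by (rule vector_derivative_at[OF M_y[OF p]])
    ultimately show "scurl S F p = ?N\<^sub>x p - ?M\<^sub>y p" by (simp add: scurl_def)
  qed
  finally show ?thesis unfolding fr_eq .
qed

end
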